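(* Let $d,N\geq 2$, $h\geq 2$ and $g\geq 1$ be integers. If $\mathcal{A}$ is a $B_h[g]$ set on $(\mathbb{Z},+)$ contained in $[0,N^d-1]$, then $[\mathcal{A}]_N$ is a $B_h[g]$ set on $(\mathbb{Z}^d,+)$ contained in $[0,N-1]^d$.
   Context: Let $(G,+)$ be an abelian group, and let $h\ge 2$, $g\ge 1$ be integers. A subset $\mathcal{A}\subseteq G$ is a $B_h[g]$ set on $G$ if every $x\in G$ can be written in at most $g$ ways as a sum of $h$ (not necessarily distinct) elements of $\mathcal{A}$, where representations $x=a_1+\cdots+a_h$ with $a_1,\ldots,a_h\in\mathcal{A}$ that differ only by rearrangement of the summands are counted as the same. For a positive integer $M$, $[0,M-1]:=\{0,1,\ldots,M-1\}$, and $[0,N-1]^d$ is the $d$-fold cartesian product of $[0,N-1]$. For an integer $a\in[0,N^d-1]$, $[a]_N:=(n_{d-1},\ldots,n_1,n_0)\in[0,N-1]^d$ denotes the $d$-tuple of base-$N$ digits of $a$ (padded with leading zeros if necessary), i.e. the unique tuple with $0\le n_j\le N-1$ and $a=n_{d-1}N^{d-1}+\cdots+n_1N+n_0$. For $\mathcal{A}\subseteq[0,N^d-1]$, $[\mathcal{A}]_N:=\{[a]_N:a\in\mathcal{A}\}\subseteq\mathbb{Z}^d$. *)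

theory Defs
  imports "HOL-Algebra.Product_Groups" "HOL-Library.Multiset"
begin

text \<open>
  The group is written multiplicatively, as always in \<^theory>\<open>HOL-Algebra.Group\<close>; the iterated
  product below is the sum of the listed elements when the operation is read additively.
  Representations are identified up to rearrangement by passing from the list of summands to its
  multiset. Finiteness is required separately because \<^const>\<open>card\<close> of an infinite set is 0.
\<close>

definition representations ::
  "('a, 'b) monoid_scheme \<Rightarrow> nat \<Rightarrow> 'a set \<Rightarrow> 'a \<Rightarrow> 'a multiset set" where
  "representations G h A x =
     {mset as |as. length as = h \<and> set as \<subseteq> A \<and> foldr (\<otimes>\<^bsub>G\<^esub>) as \<one>\<^bsub>G\<^esub> = x}"

definition Bh_set :: "('a, 'b) monoid_scheme \<Rightarrow> nat \<Rightarrow> nat \<Rightarrow> 'a set \<Rightarrow> bool" where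
  "Bh_set G h g A \<longleftrightarrow>
     A \<subseteq> carrier G \<and>
     (\<forall>x\<in>carrier G. finite (representations G h A x) \<and> card (representations G h A x) \<le> g)"

text \<open>
  Tuples of length \<open>d\<close> are extensional functions on \<open>{..<d}\<close>, which is how elements of
  \<^const>\<open>product_group\<close> are represented.
\<close>

abbreviation int_power_group :: "nat \<Rightarrow> (nat \<Rightarrow> int) monoid" where
  "int_power_group d \<equiv> product_group {..<d} (\<lambda>_. integer_group)"

lemma comm_group_int_power_group: "comm_group (int_power_group d)"
  by (rule group.group_comm_groupI) (auto simp: add.commute intro: restrict_ext)

abbreviation digit_box :: "nat \<Rightarrow> int \<Rightarrow> (nat \<Rightarrow> int) set" where
  "digit_box d N \<equiv> {..<d} \<rightarrow>\<^sub>E {0..N - 1}"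

text \<open>
  Coordinate \<open>j\<close> of the digit tuple is the coefficient of \<open>N ^ j\<close>. Lemma \<open>digits_ex1\<close> shows that the
  description is proper for every \<open>a\<close> in \<open>{0..N ^ d - 1}\<close>.
\<close>

definition digits :: "nat \<Rightarrow> int \<Rightarrow> int \<Rightarrow> nat \<Rightarrow> int" where
  "digits d N a = (THE n. n \<in> digit_box d N \<and> a = (\<Sum>j<d. n j * N ^ j))"

lemma digits_ex1:
  fixes N a :: int
  assumes "N \<ge> 1" "a \<in> {0..N ^ d - 1}"
  shows "\<exists>!n. n \<in> digit_box d N \<and> a = (\<Sum>j<d. n j * N ^ j)"
  using assms(2)
proof (induction d arbitrary: a)
  case 0
  then show ?case by (auto simp: PiE_empty_domain)
next
  case (Suc d)
  have N: "N > 0" and Nd: "N ^ d > 0" using assms(1) by auto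
  have split: "(\<Sum>j<d. n j * N ^ j) \<in> {0..N ^ d - 1}" if "\<And>j. j < d \<Longrightarrow> n j \<in> {0..N - 1}" for n d
    using that
  proof (induction d)
    case (Suc d)
    have "0 \<le> n d" "n d \<le> N - 1" using Suc.prems[of d] by auto
    then have "0 \<le> n d * N ^ d" "n d * N ^ d \<le> (N - 1) * N ^ d"
      using N by (auto intro!: mult_right_mono)
    moreover have "(\<Sum>j<d. n j * N ^ j) \<in> {0..N ^ d - 1}" using Suc by auto
    ultimately show ?case by (auto simp: algebra_simps)
  qed simp
  have r: "a mod N ^ d \<in> {0..N ^ d - 1}" using Nd by simp
  obtain m where m: "m \<in> digit_box d N" "a mod N ^ d = (\<Sum>j<d. m j * N ^ j)"
    using Suc.IH[OF r] by blast
  have q: "a div N ^ d \<in> {0..N - 1}"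
  proof -
    have "a < N * N ^ d" using Suc.prems by simp
    moreover have "a div N ^ d * N ^ d \<le> a"
      using Nd div_mult_mod_eq[of a "N ^ d"] pos_mod_sign[of "N ^ d" a] by linarith
    ultimately have "a div N ^ d * N ^ d < N * N ^ d" by linarith
    then have "a div N ^ d < N" using Nd by (simp add: mult_less_cancel_right)
    then show ?thesis using Suc.prems Nd by (simp add: pos_imp_zdiv_nonneg_iff)
  qed
  show ?case
  proof (rule ex1I)
    have "m(d := a div N ^ d) \<in> digit_box (Suc d) N"
      using m(1) q by (auto simp: PiE_iff extensional_def)
    moreover have "(\<Sum>j<d. (m(d := a div N ^ d)) j * N ^ j) = (\<Sum>j<d. m j * N ^ j)"
      by (intro sum.cong) auto
    then have "a = (\<Sum>j<Suc d. (m(d := a div N ^ d)) j * N ^ j)"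
      using div_mult_mod_eq[of a "N ^ d"] unfolding m(2) by simp
    ultimately show "m(d := a div N ^ d) \<in> digit_box (Suc d) N \<and>
        a = (\<Sum>j<Suc d. (m(d := a div N ^ d)) j * N ^ j)" by blast
  next
    fix n assume n: "n \<in> digit_box (Suc d) N \<and> a = (\<Sum>j<Suc d. n j * N ^ j)"
    define s where "s = (\<Sum>j<d. n j * N ^ j)"
    have s: "s \<in> {0..N ^ d - 1}" unfolding s_def using n by (intro split) (auto simp: PiE_iff)
    have a: "a = s + n d * N ^ d" using n by (simp add: s_def)
    have "n d = a div N ^ d" "a mod N ^ d = s"
      using int_div_pos_eq[of a "N ^ d" "n d" s] int_mod_pos_eq[of a "N ^ d" "n d" s] a s
      by (auto simp: mult.commute)
    have "restrict n {..<d} \<in> digit_box d N" using n by (auto simp: PiE_iff)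
    moreover have "a mod N ^ d = (\<Sum>j<d. restrict n {..<d} j * N ^ j)"
      using \<open>a mod N ^ d = s\<close> by (simp add: s_def)
    ultimately have eq: "restrict n {..<d} = m" using Suc.IH[OF r] m by blast
    show "n = m(d := a div N ^ d)"
    proof
      fix j
      show "n j = (m(d := a div N ^ d)) j"
        using n \<open>n d = a div N ^ d\<close> by (cases "j < d") (auto simp: eq[symmetric] PiE_iff extensional_def)
    qed
  qed
qed

end

theory Submission
  imports Defs
begin

text \<open>
  Evaluating digit tuples in base \<open>N\<close> extends to a group homomorphism from tuples of integers to
  integers, \<open>n \<mapsto> \<Sum>j<d. n j * N ^ j\<close>. It is injective on the digit tuples of \<open>A\<close> and maps them
  back onto \<open>A\<close>. Distinct representations by elements of a set on which a homomorphism is injective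
  are sent to distinct representations of the image, so the \<open>B\<^sub>h[g]\<close> property pulls back.
\<close>

lemma (in monoid) foldr_mult_closed:
  "set as \<subseteq> carrier G \<Longrightarrow> foldr (\<otimes>) as \<one> \<in> carrier G"
  by (induction as) auto

lemma (in group_hom) hom_foldr_mult:
  "set as \<subseteq> carrier G \<Longrightarrow>
    h (foldr (\<otimes>\<^bsub>G\<^esub>) as \<one>\<^bsub>G\<^esub>) = foldr (\<otimes>\<^bsub>H\<^esub>) (map h as) \<one>\<^bsub>H\<^esub>"
  by (induction as) (auto simp: G.foldr_mult_closed)

lemma set_mset_representations:
  "M \<in> representations G k A x \<Longrightarrow> set_mset M \<subseteq> A"
  by (auto simp: representations_def)

text \<open>All members of a representation lie in \<open>B\<close>, where
  \<open>inv_into B f\<close> undoes \<open>f\<close>; applied elementwise it recovers the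
  multiset.\<close>

lemma inj_on_image_mset_representations:
  assumes "inj_on f B"
  shows "inj_on (image_mset f) (representations G k B x)"
proof (rule inj_on_inverseI)
  fix M assume "M \<in> representations G k B x"
  then have "inv_into B f (f y) = y" if "y \<in># M" for y
    using that assms set_mset_representations by fastforce
  then show "image_mset (inv_into B f) (image_mset f M) = M"
    by (simp add: multiset.map_comp comp_def cong: image_mset_cong)
qed

text \<open>The inclusion can be strict: other elements of the fibre over \<open>h x\<close> may
  contribute representations too.\<close>

lemma (in group_hom) image_mset_representations_subset:
  assumes "B \<subseteq> carrier G"
  shows "image_mset h ` representations G k B x \<subseteq> representations H k (h ` B) (h x)"
proof
  fix M' assume "M' \<in> image_mset h ` representations G k B x"
  then obtain as where as: "M' = mset (map h as)" "length as = k" "set as \<subseteq> B"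
      "foldr (\<otimes>\<^bsub>G\<^esub>) as \<one>\<^bsub>G\<^esub> = x"
    by (auto simp: representations_def)
  have "foldr (\<otimes>\<^bsub>H\<^esub>) (map h as) \<one>\<^bsub>H\<^esub> = h x"
    using hom_foldr_mult[of as] as assms by auto
  then show "M' \<in> representations H k (h ` B) (h x)"
    unfolding representations_def using as by (intro CollectI exI[of _ "map h as"]) auto
qed

text \<open>Injectivity is asked on \<open>B\<close> only, since base-\<open>N\<close> evaluation on
  all integer tuples has a nontrivial kernel once \<open>d \<ge> 2\<close>.\<close>

lemma (in group_hom) Bh_set_pullback:
  assumes "Bh_set H k g (h ` B)" and "B \<subseteq> carrier G" and "inj_on h B"
  shows "Bh_set G k g B"
  unfolding Bh_set_def
proof (intro conjI ballI)
  fix x assume "x \<in> carrier G"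
  then have R: "finite (representations H k (h ` B) (h x))"
      "card (representations H k (h ` B) (h x)) \<le> g"
    using assms(1) by (auto simp: Bh_set_def)
  note inj = inj_on_image_mset_representations[OF assms(3), of G k x]
  note sub = image_mset_representations_subset[OF assms(2), of k x]
  show "finite (representations G k B x)"
    using inj_on_finite[OF inj sub R(1)] .
  show "card (representations G k B x) \<le> g"
    using card_inj_on_le[OF inj sub R(1)] R(2) by linarith
qed (fact assms(2))

lemma group_hom_base_eval:
  "group_hom (int_power_group d) integer_group (\<lambda>n. \<Sum>j<d. n j * N ^ j)"
proof -
  \<comment> \<open>The operation of \<open>product_group\<close> is restricted to
    \<open>{..<d}\<close>; the sum reads only those coordinates, so additivity survives.\<close>
  have "(\<lambda>n. \<Sum>j<d. n j * N ^ j) \<in> hom (int_power_group d) integer_group"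
    by (auto simp: hom_def distrib_right sum.distrib)
  then show ?thesis
    by (simp add: group_hom_def group_hom_axioms_def)
qed

text \<open>\<open>digits\<close> is a definite description, so both facts rest on unique
  existence.\<close>

lemma
  assumes "N \<ge> 1" "a \<in> {0..N ^ d - 1}"
  shows digits_in_digit_box: "digits d N a \<in> digit_box d N"
    and base_eval_digits: "(\<Sum>j<d. digits d N a j * N ^ j) = a"
  using theI'[OF digits_ex1[OF assms]] unfolding digits_def by auto

theorem theorem2:
  fixes d h g :: nat and N :: int and A :: "int set"
  assumes "d \<ge> 2" and "N \<ge> 2" and "h \<ge> 2" and "g \<ge> 1"
    and "Bh_set integer_group h g A"
    and "A \<subseteq> {0..N ^ d - 1}"
  shows "Bh_set (int_power_group d) h g (digits d N ` A) \<and> digits d N ` A \<subseteq> digit_box d N"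
proof
  let ?f = "\<lambda>n. \<Sum>j<d. n j * N ^ j"
  have eval: "?f (digits d N a) = a" if "a \<in> A" for a
    using that assms(2,6) by (intro base_eval_digits) auto
  show box: "digits d N ` A \<subseteq> digit_box d N"
    using assms(2,6) by (intro image_subsetI digits_in_digit_box) auto
  show "Bh_set (int_power_group d) h g (digits d N ` A)"
  proof (rule group_hom.Bh_set_pullback[OF group_hom_base_eval[of d N]])
    have "?f ` digits d N ` A = A"
      using eval by (simp add: image_image)
    then show "Bh_set integer_group h g (?f ` digits d N ` A)"
      using assms(5) by simp
    show "digits d N ` A \<subseteq> carrier (int_power_group d)"
      using box by (auto simp: PiE_iff)
    \<comment> \<open>By \<open>eval\<close>, \<open>digits d N\<close> is a left inverse of
      \<open>?f\<close> on the digit tuples of \<open>A\<close>.\<close>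
    show "inj_on ?f (digits d N ` A)"
      by (rule inj_on_inverseI[where g = "digits d N"]) (auto simp: eval)
  qed
qed

end
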